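(* Let $K$ be a field of characteristic zero, let $D$ be a digroup and let $K[D]$ be its digroup algebra. Then $$\mathrm{Glike}(K[D])=D,$$ where $D$ is identified with the canonical basis of $K[D]$. Under this identification, the products induced on $\mathrm{Glike}(K[D])$ coincide with the original digroup products on $D$, and the inverse induced by the antipode coincides with the original inverse map of $D$.
   Context: A generalized digroup is a nonempty set $D$ with two associative binary operations $\vdash,\dashv$ satisfying $x\vdash(y\dashv z)=(x\vdash y)\dashv z$, $x\dashv(y\dashv z)=x\dashv(y\vdash z)$, $(x\vdash y)\vdash z=(x\dashv y)\vdash z$, such that there is at least one bar-unit (an element $\xi$ with $x\dashv\xi=x=\xi\vdash x$ for all $x$), and for every bar-unit $\xi$ and every $x\in D$ there are $x^{-1}_{r,\xi},x^{-1}_{l,\xi}\in D$ with $x\vdash x^{-1}_{r,\xi}=\xi$ and $x^{-1}_{l,\xi}\dashv x=\xi$. A digroup is a generalized digroup with a distinguished bar-unit $\xi$ such that every $x\in D$ admits a single inverse $x^{-1}$ satisfying $x\vdash x^{-1}=\xi=x^{-1}\dashv x$. No finiteness of $D$ is assumed. The digroup algebra of $D$ is the free $K$-vector space $K[D]=\bigoplus_{x\in D}Kx$ with the bilinear extensions of $\vdash,\dashv$, the element $\xi$, and the linear maps determined by $\Delta(x)=x\otimes x$, $\varepsilon(x)=1$, $S(x)=x^{-1}$ for $x\in D$ (it is a cocommutative Hopf dialgebra with antipode $S$). For a coalgebra $C$, $\mathrm{Glike}(C)=\{g\in C\mid\Delta(g)=g\otimes g,\ \varepsilon(g)=1\}$.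 $\mathrm{Glike}(K[D])$ carries the restrictions of $\vdash$ and $\dashv$, and the inverse $g\mapsto S(g)$. *)

theory Defs
  imports Complex_Main "HOL-Library.Poly_Mapping"
begin

section \<open>Digroups\<close>

definition is_bar_unit :: "'d set \<Rightarrow> ('d \<Rightarrow> 'd \<Rightarrow> 'd) \<Rightarrow> ('d \<Rightarrow> 'd \<Rightarrow> 'd) \<Rightarrow> 'd \<Rightarrow> bool" where
  "is_bar_unit D vd dv \<xi> \<longleftrightarrow> \<xi> \<in> D \<and> (\<forall>x\<in>D. dv x \<xi> = x \<and> vd \<xi> x = x)"

locale generalized_digroup =
  fixes D :: "'d set"
    and vd :: "'d \<Rightarrow> 'd \<Rightarrow> 'd"  (infixl \<open>\<turnstile>\<close> 70)
    and dv :: "'d \<Rightarrow> 'd \<Rightarrow> 'd"  (infixl \<open>\<stileturn>\<close> 70)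
  assumes vd_closed: "\<lbrakk>x \<in> D; y \<in> D\<rbrakk> \<Longrightarrow> x \<turnstile> y \<in> D"
    and dv_closed: "\<lbrakk>x \<in> D; y \<in> D\<rbrakk> \<Longrightarrow> x \<stileturn> y \<in> D"
    and vd_assoc: "\<lbrakk>x \<in> D; y \<in> D; z \<in> D\<rbrakk> \<Longrightarrow> (x \<turnstile> y) \<turnstile> z = x \<turnstile> (y \<turnstile> z)"
    and dv_assoc: "\<lbrakk>x \<in> D; y \<in> D; z \<in> D\<rbrakk> \<Longrightarrow> (x \<stileturn> y) \<stileturn> z = x \<stileturn> (y \<stileturn> z)"
    and inner_assoc: "\<lbrakk>x \<in> D; y \<in> D; z \<in> D\<rbrakk> \<Longrightarrow> x \<turnstile> (y \<stileturn> z) = (x \<turnstile> y) \<stileturn> z"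
    and bar_right: "\<lbrakk>x \<in> D; y \<in> D; z \<in> D\<rbrakk> \<Longrightarrow> x \<stileturn> (y \<stileturn> z) = x \<stileturn> (y \<turnstile> z)"
    and bar_left: "\<lbrakk>x \<in> D; y \<in> D; z \<in> D\<rbrakk> \<Longrightarrow> (x \<turnstile> y) \<turnstile> z = (x \<stileturn> y) \<turnstile> z"
    and ex_bar_unit: "\<exists>\<xi>. is_bar_unit D (\<turnstile>) (\<stileturn>) \<xi>"
    and ex_right_inverse:
      "\<lbrakk>is_bar_unit D (\<turnstile>) (\<stileturn>) \<xi>; x \<in> D\<rbrakk> \<Longrightarrow> \<exists>y\<in>D. x \<turnstile> y = \<xi>"
    and ex_left_inverse:
      "\<lbrakk>is_bar_unit D (\<turnstile>) (\<stileturn>) \<xi>; x \<in> D\<rbrakk> \<Longrightarrow> \<exists>y\<in>D. y \<stileturn> x = \<xi>"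

locale digroup = generalized_digroup D vd dv
  for D :: "'d set"
    and vd :: "'d \<Rightarrow> 'd \<Rightarrow> 'd"  (infixl \<open>\<turnstile>\<close> 70)
    and dv :: "'d \<Rightarrow> 'd \<Rightarrow> 'd"  (infixl \<open>\<stileturn>\<close> 70) +
  fixes \<xi> :: 'd
  assumes bar_unit: "is_bar_unit D (\<turnstile>) (\<stileturn>) \<xi>"
    and ex1_inverse: "x \<in> D \<Longrightarrow> \<exists>!y. y \<in> D \<and> x \<turnstile> y = \<xi> \<and> y \<stileturn> x = \<xi>"

definition digroup_inv ::
    "'d set \<Rightarrow> ('d \<Rightarrow> 'd \<Rightarrow> 'd) \<Rightarrow> ('d \<Rightarrow> 'd \<Rightarrow> 'd) \<Rightarrow> 'd \<Rightarrow> 'd \<Rightarrow> 'd" where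
  "digroup_inv D vd dv \<xi> x = (THE y. y \<in> D \<and> vd x y = \<xi> \<and> dv y x = \<xi>)"


section \<open>Free vector spaces\<close>

definition fs_scale :: "'k::field \<Rightarrow> ('a \<Rightarrow>\<^sub>0 'k) \<Rightarrow> ('a \<Rightarrow>\<^sub>0 'k)" where
  "fs_scale c f = Poly_Mapping.map ((*) c) f"

lemma lookup_fs_scale [simp]: "Poly_Mapping.lookup (fs_scale c f) x = c * Poly_Mapping.lookup f x"
  by (simp add: fs_scale_def map.rep_eq when_def)

global_interpretation fs: vector_space "fs_scale :: 'k::field \<Rightarrow> ('a \<Rightarrow>\<^sub>0 'k) \<Rightarrow> ('a \<Rightarrow>\<^sub>0 'k)"
  by unfold_locales (auto intro!: poly_mapping_eqI simp: lookup_add algebra_simps)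

abbreviation fs_basis :: "'a \<Rightarrow> ('a \<Rightarrow>\<^sub>0 'k::field)" where
  "fs_basis x \<equiv> Poly_Mapping.single x 1"

definition free_space :: "'a set \<Rightarrow> ('a \<Rightarrow>\<^sub>0 'k::field) set" where
  "free_space A = {f. Poly_Mapping.keys f \<subseteq> A}"

definition lin_ext ::
    "('k::field \<Rightarrow> 'v \<Rightarrow> 'v::ab_group_add) \<Rightarrow> ('a \<Rightarrow> 'v) \<Rightarrow> ('a \<Rightarrow>\<^sub>0 'k) \<Rightarrow> 'v" where
  "lin_ext scale \<phi> f = (\<Sum>x\<in>Poly_Mapping.keys f. scale (Poly_Mapping.lookup f x) (\<phi> x))"

lemma lin_ext_fs_basis [simp]:
  assumes "vector_space scale"
  shows "lin_ext scale \<phi> (fs_basis x) = \<phi> x"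
  using vector_space.vector_space_assms(4)[OF assms] by (simp add: lin_ext_def)


section \<open>Tensor products and group-like elements\<close>

text \<open>
  For subspaces \<open>V\<close>, \<open>W\<close> of ambient vector spaces with scalings \<open>s\<close>, \<open>s'\<close>, the space
  \<open>V \<otimes> W\<close> is the quotient of the free vector space on \<open>V \<times> W\<close> by the subspace spanned by the
  bilinearity relations. Its elements are cosets, i.e. sets of formal combinations of pairs.
\<close>

definition tensor_relations ::
    "('k::field \<Rightarrow> 'v \<Rightarrow> 'v) \<Rightarrow> ('k \<Rightarrow> 'w \<Rightarrow> 'w) \<Rightarrow> 'v::ab_group_add set \<Rightarrow> 'w::ab_group_add set
      \<Rightarrow> ('v \<times> 'w \<Rightarrow>\<^sub>0 'k) set" where
  "tensor_relations s s' V W = fs.span (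
     {fs_basis (v + v', w) - fs_basis (v, w) - fs_basis (v', w) | v v' w. v \<in> V \<and> v' \<in> V \<and> w \<in> W} \<union>
     {fs_basis (v, w + w') - fs_basis (v, w) - fs_basis (v, w') | v w w'. v \<in> V \<and> w \<in> W \<and> w' \<in> W} \<union>
     {fs_basis (s c v, w) - fs_scale c (fs_basis (v, w)) | c v w. v \<in> V \<and> w \<in> W} \<union>
     {fs_basis (v, s' c w) - fs_scale c (fs_basis (v, w)) | c v w. v \<in> V \<and> w \<in> W})"

definition tensor_class ::
    "('k::field \<Rightarrow> 'v \<Rightarrow> 'v) \<Rightarrow> ('k \<Rightarrow> 'w \<Rightarrow> 'w) \<Rightarrow> 'v::ab_group_add set \<Rightarrow> 'w::ab_group_add set
      \<Rightarrow> ('v \<times> 'w \<Rightarrow>\<^sub>0 'k) \<Rightarrow> ('v \<times> 'w \<Rightarrow>\<^sub>0 'k) set" where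
  "tensor_class s s' V W t = {u \<in> free_space (V \<times> W). u - t \<in> tensor_relations s s' V W}"

definition tensor ::
    "('k::field \<Rightarrow> 'v \<Rightarrow> 'v) \<Rightarrow> ('k \<Rightarrow> 'w \<Rightarrow> 'w) \<Rightarrow> 'v::ab_group_add set \<Rightarrow> 'w::ab_group_add set
      \<Rightarrow> 'v \<Rightarrow> 'w \<Rightarrow> ('v \<times> 'w \<Rightarrow>\<^sub>0 'k) set" where
  "tensor s s' V W v w = tensor_class s s' V W (fs_basis (v, w))"

text \<open>Here \<open>C\<close> is a coalgebra with comultiplication \<open>\<Delta> : C \<rightarrow> C \<otimes> C\<close> and counit \<open>\<epsilon>\<close>.\<close>

definition Glike ::
    "('k::field \<Rightarrow> 'c \<Rightarrow> 'c) \<Rightarrow> 'c::ab_group_add set \<Rightarrow> ('c \<Rightarrow> ('c \<times> 'c \<Rightarrow>\<^sub>0 'k) set) \<Rightarrow> ('c \<Rightarrow> 'k)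
      \<Rightarrow> 'c set" where
  "Glike s C \<Delta> \<epsilon> = {g \<in> C. \<Delta> g = tensor s s C C g g \<and> \<epsilon> g = 1}"


section \<open>The digroup algebra\<close>

text \<open>
  The underlying space \<open>K[D]\<close> is \<open>free_space D\<close>, with \<open>x \<in> D\<close> identified with \<open>fs_basis x\<close>.
  The comultiplication is the linear map with \<open>x \<mapsto> x \<otimes> x\<close>: since the passage to
  cosets is linear, \<open>\<Sum> f\<^sub>x x\<close> goes to the class of the formal combination \<open>\<Sum> f\<^sub>x (x, x)\<close>.
\<close>

definition kd_comul ::
    "'d set \<Rightarrow> ('d \<Rightarrow>\<^sub>0 'k::field) \<Rightarrow> (('d \<Rightarrow>\<^sub>0 'k) \<times> ('d \<Rightarrow>\<^sub>0 'k) \<Rightarrow>\<^sub>0 'k) set" where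
  "kd_comul D f = tensor_class fs_scale fs_scale (free_space D) (free_space D)
     (lin_ext fs_scale (\<lambda>x. fs_basis (fs_basis x, fs_basis x)) f)"

definition kd_counit :: "('d \<Rightarrow>\<^sub>0 'k::field) \<Rightarrow> 'k" where
  "kd_counit = lin_ext (*) (\<lambda>x. 1)"

definition kd_antipode ::
    "'d set \<Rightarrow> ('d \<Rightarrow> 'd \<Rightarrow> 'd) \<Rightarrow> ('d \<Rightarrow> 'd \<Rightarrow> 'd) \<Rightarrow> 'd
      \<Rightarrow> ('d \<Rightarrow>\<^sub>0 'k::field) \<Rightarrow> ('d \<Rightarrow>\<^sub>0 'k)" where
  "kd_antipode D vd dv \<xi> = lin_ext fs_scale (\<lambda>x. fs_basis (digroup_inv D vd dv \<xi> x))"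

definition kd_prod ::
    "('d \<Rightarrow> 'd \<Rightarrow> 'd) \<Rightarrow> ('d \<Rightarrow>\<^sub>0 'k::field) \<Rightarrow> ('d \<Rightarrow>\<^sub>0 'k) \<Rightarrow> ('d \<Rightarrow>\<^sub>0 'k)" where
  "kd_prod m f g =
     lin_ext fs_scale (\<lambda>x. lin_ext fs_scale (\<lambda>y. fs_basis (m x y)) g) f"

definition kd_Glike :: "'d set \<Rightarrow> ('d \<Rightarrow>\<^sub>0 'k::field) set" where
  "kd_Glike D = Glike fs_scale (free_space D) (kd_comul D) kd_counit"

lemma kd_comul_fs_basis:
  "kd_comul D (fs_basis x :: 'd \<Rightarrow>\<^sub>0 'k::field) =
     tensor fs_scale fs_scale (free_space D) (free_space D) (fs_basis x) (fs_basis x)"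
  by (simp add: kd_comul_def tensor_def fs.vector_space_axioms)

end

theory Submission
  imports Defs
begin

text \<open>
  For points \<open>a\<close> and \<open>b\<close>, the functional \<open>(v, w) \<mapsto> v\<^sub>a w\<^sub>b\<close> is bilinear, hence descends to the tensor
  product. Applied to \<open>\<Delta> g = g \<otimes> g\<close> it yields \<open>g\<^sub>a g\<^sub>b = \<delta>\<^sub>a\<^sub>b g\<^sub>a\<close>, so the coefficients of a
  group-like \<open>g\<close> are orthogonal idempotents of the field, with sum \<open>\<epsilon> g = 1\<close>; exactly one
  of them is \<open>1\<close> and the others vanish.
\<close>

text \<open>Coefficients vanish off the support, so the extra summands are zero. This lets
  extensions of several vectors be compared over one common index set.\<close>

lemma lin_ext_superset:
  assumes "vector_space scale" "finite A" "Poly_Mapping.keys f \<subseteq> A"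
  shows "lin_ext scale \<phi> f = (\<Sum>x\<in>A. scale (Poly_Mapping.lookup f x) (\<phi> x))"
proof -
  interpret vector_space scale by fact
  show ?thesis
    unfolding lin_ext_def using assms(2,3)
    by (intro sum.mono_neutral_left) (auto simp: in_keys_iff)
qed

lemma linear_lin_ext:
  fixes \<phi> :: "'a \<Rightarrow> 'v::ab_group_add" and scale :: "'k::field \<Rightarrow> 'v \<Rightarrow> 'v"
  assumes "vector_space scale"
  shows "Vector_Spaces.linear fs_scale scale (lin_ext scale \<phi>)"
proof -
  interpret vector_space scale by fact
  show ?thesis
  proof unfold_locales
    fix f g :: "'a \<Rightarrow>\<^sub>0 'k"
    let ?A = "Poly_Mapping.keys f \<union> Poly_Mapping.keys g"
    have "Poly_Mapping.keys (f + g) \<subseteq> ?A"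
      by (rule keys_add)
    then show "lin_ext scale \<phi> (f + g) = lin_ext scale \<phi> f + lin_ext scale \<phi> g"
      by (simp add: lin_ext_superset[OF assms, of ?A] lookup_add scale_left_distrib sum.distrib)
  next
    fix c and f :: "'a \<Rightarrow>\<^sub>0 'k"
    \<comment> \<open>Only an inclusion: for \<open>c = 0\<close> the support becomes empty.\<close>
    have "Poly_Mapping.keys (fs_scale c f) \<subseteq> Poly_Mapping.keys f"
      by (auto simp: in_keys_iff)
    then show "lin_ext scale \<phi> (fs_scale c f) = scale c (lin_ext scale \<phi> f)"
      by (simp add: lin_ext_superset[OF assms, of "Poly_Mapping.keys f"] scale_sum_right)
  qed
qed

lemma vector_space_field: "vector_space ((*) :: 'k::field \<Rightarrow> 'k \<Rightarrow> 'k)"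
  by unfold_locales (simp_all add: algebra_simps)

text \<open>Each bilinearity hypothesis kills one of the four families of generators, and a linear
  map that is zero on generators is zero on their span. This is how a bilinear form descends to the
  tensor product.\<close>

lemma lin_ext_tensor_relations:
  fixes \<beta> :: "'v::ab_group_add \<times> 'w::ab_group_add \<Rightarrow> 'k::field"
  assumes r: "r \<in> tensor_relations s s' V W"
    and add_left: "\<And>v v' w. \<beta> (v + v', w) = \<beta> (v, w) + \<beta> (v', w)"
    and add_right: "\<And>v w w'. \<beta> (v, w + w') = \<beta> (v, w) + \<beta> (v, w')"
    and scale_left: "\<And>c v w. \<beta> (s c v, w) = c * \<beta> (v, w)"
    and scale_right: "\<And>c v w. \<beta> (v, s' c w) = c * \<beta> (v, w)"
  shows "lin_ext (*) \<beta> r = 0"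
proof -
  interpret L: Vector_Spaces.linear fs_scale "(*)" "lin_ext (*) \<beta>"
    by (rule linear_lin_ext[OF vector_space_field])
  show ?thesis
    by (rule L.eq_0_on_span[OF _ r[unfolded tensor_relations_def]])
      (auto simp: L.diff L.scale lin_ext_fs_basis[OF vector_space_field]
        add_left add_right scale_left scale_right)
qed

text \<open>A class contains only elements of \<open>free_space (V \<times> W)\<close>, so the
  second assumption is what puts \<open>t\<close> into its own class.\<close>

lemma tensor_class_eqD:
  assumes "tensor_class s s' V W t = tensor_class s s' V W u" "t \<in> free_space (V \<times> W)"
  shows "t - u \<in> tensor_relations s s' V W"
proof -
  have "t \<in> tensor_class s s' V W t"
    using assms(2) by (simp add: tensor_class_def tensor_relations_def fs.span_zero)
  then have "t \<in> tensor_class s s' V W u"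
    unfolding assms(1) .
  then show ?thesis
    by (simp add: tensor_class_def)
qed

lemma lin_ext_in_free_space:
  assumes "\<And>x. x \<in> Poly_Mapping.keys f \<Longrightarrow> \<phi> x \<in> free_space A"
  shows "lin_ext fs_scale \<phi> f \<in> free_space A"
proof -
  have "Poly_Mapping.lookup (lin_ext fs_scale \<phi> f) y = 0" if "y \<notin> A" for y
  proof -
    have "Poly_Mapping.lookup (\<phi> x) y = 0" if "x \<in> Poly_Mapping.keys f" for x
      using assms[OF that] \<open>y \<notin> A\<close> by (auto simp: free_space_def in_keys_iff)
    then show ?thesis
      by (simp add: lin_ext_def lookup_sum)
  qed
  then show ?thesis
    by (auto simp: free_space_def in_keys_iff)
qed

lemma fs_basis_in_free_space_iff [simp]: "fs_basis x \<in> free_space A \<longleftrightarrow> x \<in> A"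
  by (simp add: free_space_def)

lemma kd_Glike_lookup_mult:
  fixes g :: "'d \<Rightarrow>\<^sub>0 'k::field"
  assumes "g \<in> kd_Glike D"
  shows "Poly_Mapping.lookup g a * Poly_Mapping.lookup g b =
    (if a = b then Poly_Mapping.lookup g a else 0)"
proof -
  let ?V = "free_space D :: ('d \<Rightarrow>\<^sub>0 'k) set"
  let ?\<beta> = "\<lambda>(v, w). Poly_Mapping.lookup v a * Poly_Mapping.lookup w b :: 'k"
  let ?t = "lin_ext fs_scale (\<lambda>x. fs_basis (fs_basis x, fs_basis x)) g
    :: ('d \<Rightarrow>\<^sub>0 'k) \<times> ('d \<Rightarrow>\<^sub>0 'k) \<Rightarrow>\<^sub>0 'k"
  interpret L: Vector_Spaces.linear fs_scale "(*)" "lin_ext (*) ?\<beta>"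
    by (rule linear_lin_ext[OF vector_space_field])
  have g: "Poly_Mapping.keys g \<subseteq> D"
    and cls: "tensor_class fs_scale fs_scale ?V ?V ?t =
      tensor_class fs_scale fs_scale ?V ?V (fs_basis (g, g))"
    using assms by (auto simp: kd_Glike_def Glike_def free_space_def kd_comul_def tensor_def)
  have "?t \<in> free_space (?V \<times> ?V)"
    using g by (intro lin_ext_in_free_space) auto
  with cls have "?t - fs_basis (g, g) \<in> tensor_relations fs_scale fs_scale ?V ?V"
    by (rule tensor_class_eqD)
  then have "lin_ext (*) ?\<beta> (?t - fs_basis (g, g)) = 0"
    by (rule lin_ext_tensor_relations) (simp_all add: lookup_add distrib_left distrib_right)
  then have "lin_ext (*) ?\<beta> ?t = Poly_Mapping.lookup g a * Poly_Mapping.lookup g b"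
    by (simp add: L.diff lin_ext_fs_basis[OF vector_space_field])
  moreover have "lin_ext (*) ?\<beta> ?t =
      (\<Sum>x\<in>Poly_Mapping.keys g. if x = a then (if a = b then Poly_Mapping.lookup g a else 0) else 0)"
    \<comment> \<open>Only the inner extension \<open>?t\<close> is unfolded; the outer functional
      stays folded and moves through the sum by linearity. On the pair of basis vectors at
      \<open>x\<close> its value is 1 if \<open>x = a\<close> and \<open>x = b\<close>, and 0
      otherwise.\<close>
    unfolding lin_ext_def[of fs_scale] L.sum L.scale lin_ext_fs_basis[OF vector_space_field]
    by (intro sum.cong) (auto simp: lookup_single when_def)
  \<comment> \<open>If \<open>a\<close> lies outside the support, the sum is 0, which agrees with
    the coefficient of \<open>g\<close> at \<open>a\<close>.\<close>
  ultimately show ?thesis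
    by (auto simp: in_keys_iff split: if_splits)
qed

lemma kd_counit_fs_basis [simp]: "kd_counit (fs_basis x) = (1 :: 'k::field)"
  by (simp add: kd_counit_def lin_ext_fs_basis[OF vector_space_field])

lemma kd_Glike_eq: "(kd_Glike D :: ('d \<Rightarrow>\<^sub>0 'k::field) set) = fs_basis ` D"
proof (intro subset_antisym subsetI)
  fix g :: "'d \<Rightarrow>\<^sub>0 'k" assume g: "g \<in> kd_Glike D"
  then have "kd_counit g = 1" and gD: "Poly_Mapping.keys g \<subseteq> D"
    by (auto simp: kd_Glike_def Glike_def free_space_def)
  \<comment> \<open>With empty support the counit would be an empty sum, hence 0 instead of
    1.\<close>
  then have "Poly_Mapping.keys g \<noteq> {}"
    by (auto simp: kd_counit_def lin_ext_def)
  then obtain a where a: "a \<in> Poly_Mapping.keys g"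
    by blast
  \<comment> \<open>The coefficient at \<open>a\<close> is nonzero, so it cancels from the product
    identity.\<close>
  have "Poly_Mapping.lookup g b = (if a = b then 1 else 0)" for b
    using kd_Glike_lookup_mult[OF g, of a b] a by (auto simp: in_keys_iff)
  then have "g = fs_basis a"
    by (intro poly_mapping_eqI) (auto simp: lookup_single when_def)
  then show "g \<in> fs_basis ` D"
    using a gD by blast
next
  fix g :: "'d \<Rightarrow>\<^sub>0 'k" assume "g \<in> fs_basis ` D"
  then show "g \<in> kd_Glike D"
    by (auto simp: kd_Glike_def Glike_def kd_comul_fs_basis)
qed

theorem proposition5p11:
  fixes D :: "'d set"
    and vd :: "'d \<Rightarrow> 'd \<Rightarrow> 'd" (infixl \<open>\<turnstile>\<close> 70)
    and dv :: "'d \<Rightarrow> 'd \<Rightarrow> 'd" (infixl \<open>\<stileturn>\<close> 70)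
    and \<xi> :: 'd
  assumes "digroup D (\<turnstile>) (\<stileturn>) \<xi>"
  shows "bij_betw (fs_basis :: 'd \<Rightarrow> 'd \<Rightarrow>\<^sub>0 'k::field_char_0) D (kd_Glike D)
    \<and> (\<forall>x\<in>D. \<forall>y\<in>D.
          kd_prod (\<turnstile>) (fs_basis x :: 'd \<Rightarrow>\<^sub>0 'k) (fs_basis y) = fs_basis (x \<turnstile> y)
        \<and> kd_prod (\<stileturn>) (fs_basis x :: 'd \<Rightarrow>\<^sub>0 'k) (fs_basis y) = fs_basis (x \<stileturn> y))
    \<and> (\<forall>x\<in>D. kd_antipode D (\<turnstile>) (\<stileturn>) \<xi> (fs_basis x :: 'd \<Rightarrow>\<^sub>0 'k)
          = fs_basis (digroup_inv D (\<turnstile>) (\<stileturn>) \<xi> x))"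
proof -
  have "inj_on (fs_basis :: 'd \<Rightarrow> 'd \<Rightarrow>\<^sub>0 'k) D"
  proof (rule inj_onI)
    fix x y
    assume "fs_basis x = (fs_basis y :: 'd \<Rightarrow>\<^sub>0 'k)"
    then have "Poly_Mapping.keys (fs_basis x :: 'd \<Rightarrow>\<^sub>0 'k) = Poly_Mapping.keys (fs_basis y :: 'd \<Rightarrow>\<^sub>0 'k)"
      by (rule arg_cong)
    then show "x = y"
      by simp
  qed
  then show ?thesis
    \<comment> \<open>Products and antipode are linear extensions, so on basis vectors they return
      the prescribed values.\<close>
    by (simp add: bij_betw_def kd_Glike_eq kd_prod_def kd_antipode_def fs.vector_space_axioms)
qed

end
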